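(* For every fixed integer $n\ge 1$, the number $B_{m,n}$ of bimonotone subdivisions of $P_{m,n}$ is asymptotically equivalent to the total number $A_{m,n}$ of subdivisions of $P_{m,n}$ as $m\to\infty$, that is, $$\lim_{m\to\infty}\frac{B_{m,n}}{A_{m,n}}=1.$$
   Context: For integers $m,n\ge 1$, the point configuration $P_{m,n}\subset\mathbb R^2$ is the two-row grid consisting of the $n$ bottom points $(0,0),(1,0),\dots,(n-1,0)$ and the $m$ top points $(0,1),(1,1),\dots,(m-1,1)$. A subdivision of a finite point configuration $\mathcal A\subset\mathbb R^2$ is a collection of convex polygons (two-dimensional, with nonempty interior, regarded as convex sets) whose vertices lie in $\mathcal A$, such that the union of the polygons is the convex hull of $\mathcal A$ and each pair of distinct polygons either does not intersect or intersects exactly in a common vertex or a common side. Not all points of $\mathcal A$ need to be vertices of polygons. A polygon is bimonotone if every one of its edges is vertical or has nonnegative slope. A subdivision is bimonotone if all of its polygons are bimonotone. $B_{m,n}$ denotes the number of bimonotone subdivisions of $P_{m,n}$, and $A_{m,n}$ the number of all subdivisions of $P_{m,n}$. *)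

theory Defs
  imports "HOL-Analysis.Analysis"
begin

type_synonym point = "real \<times> real"

definition grid :: "nat \<Rightarrow> nat \<Rightarrow> point set" where
  "grid m n = {(real i, 0) | i. i < n} \<union> {(real j, 1) | j. j < m}"

definition convex_polygon :: "point set \<Rightarrow> bool" where
  "convex_polygon Q \<longleftrightarrow> polytope Q \<and> interior Q \<noteq> {}"

text \<open>Vertices are extreme points and sides are one-dimensional faces, so a point of the
  configuration lying in the relative interior of a side is not a vertex. No finiteness condition
  on the collection is needed: a polygon is the convex hull of its vertices, so a finite
  configuration admits only finitely many polygons.\<close>

definition subdivision :: "point set \<Rightarrow> point set set \<Rightarrow> bool" where
  "subdivision A S \<longleftrightarrow>
     (\<forall>Q\<in>S. convex_polygon Q \<and> {v. v extreme_point_of Q} \<subseteq> A) \<and>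
     \<Union>S = convex hull A \<and>
     (\<forall>Q\<in>S. \<forall>R\<in>S. Q \<noteq> R \<longrightarrow>
        Q \<inter> R = {} \<or>
        (\<exists>v. Q \<inter> R = {v} \<and> v extreme_point_of Q \<and> v extreme_point_of R) \<or>
        (Q \<inter> R edge_of Q \<and> Q \<inter> R edge_of R))"

text \<open>Every edge of a polytope is a closed segment, and its endpoints are distinct because it has
  affine dimension 1; hence the quotient is a genuine slope when the edge is not vertical.\<close>

definition bimonotone :: "point set \<Rightarrow> bool" where
  "bimonotone Q \<longleftrightarrow>
     (\<forall>p q. closed_segment p q edge_of Q \<longrightarrow>
        fst p = fst q \<or> (snd q - snd p) / (fst q - fst p) \<ge> 0)"

definition bimonotone_subdivision :: "point set \<Rightarrow> point set set \<Rightarrow> bool" where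
  "bimonotone_subdivision A S \<longleftrightarrow> subdivision A S \<and> (\<forall>Q\<in>S. bimonotone Q)"

definition num_subdivisions :: "nat \<Rightarrow> nat \<Rightarrow> nat" where
  "num_subdivisions m n = card {S. subdivision (grid m n) S}"

definition num_bimonotone_subdivisions :: "nat \<Rightarrow> nat \<Rightarrow> nat" where
  "num_bimonotone_subdivisions m n = card {S. bimonotone_subdivision (grid m n) S}"

end

theory Submission
  imports Defs
begin

text \<open>The non-horizontal edges of a subdivision are segments from (i, 0) to (j, 1); they do not cross,
  so the pairs (i, j) form a chain from (0, 0) to (n - 1, m - 1) in the product order. The polygons
  are the regions between consecutive elements of the chain, and this makes subdivisions correspond
  bijectively to chains. A subdivision is bimonotone as soon as its chain has no pair with j < i.

  Write N for the number of chains between two points. Splitting off the last element gives a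
  recurrence from which N((0, 0), (p, q)) is at least of order \<open>2^q q^p\<close>, while N((i, j), (p, q)) is
  at most of order \<open>2^q q^(p - i)\<close>. There are only boundedly many pairs (i, j) with j < i < n, all
  with i at least 1, so the chains through them form a vanishing fraction as m grows.\<close>

section \<open>Chains in the product order\<close>

text \<open>The count of chains from a fixed start satisfies, away from that start, N(p, q + 1) = 2
  N(p, q) + sum of N(x, q + 1) over x < p. For fixed p this is a linear recurrence in q whose root 2
  is repeated once per column, so every column passed adds one power of q; a chain forced through
  (i, j) forfeits the powers of i columns. For the limit it suffices to bound the bimonotone
  subdivisions below by the chains without pairs j < i, since the total bounds them above. On the
  geometric side a subdivision is just a collection of convex sets, so its left-to-right order has
  to be extracted: disjoint interiors order any two polygons, and covering the hull excludes gaps.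
  Both are read off on horizontal lines strictly between the rows, because there distinct comparable
  segments are separated even if they share an endpoint.\<close>

definition chains_between :: "'a::order \<Rightarrow> 'a \<Rightarrow> 'a set set" where
  "chains_between u v =
     {C. C \<subseteq> {u..v} \<and> u \<in> C \<and> v \<in> C \<and> (\<forall>x\<in>C. \<forall>y\<in>C. x \<le> y \<or> y \<le> x)}"

lemma finite_prod_Icc [simp]: "finite {u..v :: nat \<times> nat}"
proof (rule finite_subset)
  show "{u..v} \<subseteq> {fst u..fst v} \<times> {snd u..snd v}"
    by (auto simp: less_eq_prod_def)
qed simp

lemma finite_chains_between:
  assumes "finite {u..v}"
  shows "finite (chains_between u v)"
  by (rule finite_subset[of _ "Pow {u..v}"]) (auto simp: chains_between_def assms)

lemma chains_between_refl: "chains_between u u = {{u}}"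
  by (auto simp: chains_between_def)

lemma chains_between_empty: "\<not> u \<le> v \<Longrightarrow> chains_between u v = {}"
  by (auto simp: chains_between_def)

lemma card_chains_between_pos:
  assumes "finite {u..v}" "u \<le> v"
  shows "1 \<le> card (chains_between u v)"
proof -
  have "{u, v} \<in> chains_between u v"
    using assms by (auto simp: chains_between_def)
  then show ?thesis
    using finite_chains_between[OF assms(1)] by (metis One_nat_def Suc_leI card_gt_0_iff empty_iff)
qed

text \<open>The index \<open>w\<close> is the element just below \<open>v\<close>: once
  \<open>v\<close> is removed, a maximal element of the remaining chain is its greatest.\<close>

lemma chains_between_decompose:
  assumes fin: "finite {u..v}" and "u < v"
  shows "chains_between u v = (\<Union>w\<in>{u..<v}. insert v ` chains_between u w)"
proof (intro equalityI subsetI)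
  fix C assume "C \<in> chains_between u v"
  then have C: "C \<subseteq> {u..v}" "u \<in> C" "v \<in> C" "\<And>x y. x \<in> C \<Longrightarrow> y \<in> C \<Longrightarrow> x \<le> y \<or> y \<le> x"
    by (auto simp: chains_between_def)
  have "finite (C - {v})" "u \<in> C - {v}"
    using C fin \<open>u < v\<close> by (auto intro: finite_subset)
  then obtain w where w: "w \<in> C - {v}" "\<And>x. x \<in> C - {v} \<Longrightarrow> w \<le> x \<Longrightarrow> w = x"
    using finite_has_maximal[of "C - {v}"] by blast
  have "C - {v} \<in> chains_between u w"
  proof -
    have "C - {v} \<subseteq> {u..w}"
    proof
      fix x assume "x \<in> C - {v}"
      then show "x \<in> {u..w}" using C w by (metis Diff_iff atLeastAtMost_iff subsetD)
    qed
    then show ?thesis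
      using C w(1) \<open>u < v\<close> by (simp add: chains_between_def)
  qed
  moreover have "w \<in> {u..<v}"
    using w(1) C(1) by (metis Diff_iff atLeastAtMost_iff atLeastLessThan_iff insertI1 order_le_less subsetD)
  moreover have "C = insert v (C - {v})" using C by auto
  ultimately show "C \<in> (\<Union>w\<in>{u..<v}. insert v ` chains_between u w)" by blast
next
  fix C assume "C \<in> (\<Union>w\<in>{u..<v}. insert v ` chains_between u w)"
  then obtain w D where w: "u \<le> w" "w < v" and D: "D \<subseteq> {u..w}" "u \<in> D"
    "\<forall>x\<in>D. \<forall>y\<in>D. x \<le> y \<or> y \<le> x" and "C = insert v D"
    by (auto simp: chains_between_def)
  moreover have "D \<subseteq> {u..v}" using D(1) w by (meson atLeastatMost_subset_iff less_imp_le order.trans order.refl)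
  ultimately show "C \<in> chains_between u v"
    by (auto simp: chains_between_def)
qed

lemma card_chains_between_rec:
  assumes fin: "finite {u..v}" and "u < v"
  shows "card (chains_between u v) = (\<Sum>w\<in>{u..<v}. card (chains_between u w))"
proof -
  have fin': "finite {u..<v}" by (rule finite_subset[OF _ fin]) auto
  have finw: "finite (chains_between u w)" if "w \<in> {u..<v}" for w
    using that by (intro finite_chains_between finite_subset[OF _ fin]) auto
  have notin: "v \<notin> C" if "w \<in> {u..<v}" "C \<in> chains_between u w" for w C
  proof
    assume "v \<in> C"
    then have "v \<le> w" using that by (auto simp: chains_between_def)
    then show False using that by auto
  qed
  have inj: "inj_on (insert v) (chains_between u w)" if "w \<in> {u..<v}" for w
    by (rule inj_onI) (metis notin[OF that] insert_ident)
  \<comment> \<open>The union is disjoint because removing \<open>v\<close> recovers the smaller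
    chain, whose greatest element is \<open>w\<close>.\<close>
  have disj: "insert v ` chains_between u w \<inter> insert v ` chains_between u w' = {}"
    if "w \<in> {u..<v}" "w' \<in> {u..<v}" "w \<noteq> w'" for w w'
  proof (rule ccontr)
    assume "insert v ` chains_between u w \<inter> insert v ` chains_between u w' \<noteq> {}"
    then obtain C D where CD: "C \<in> chains_between u w" "D \<in> chains_between u w'"
      "insert v C = insert v D" by blast
    then have "C = D" using notin that by (metis insert_ident)
    then have "w \<le> w'" "w' \<le> w"
      using CD(1,2) unfolding chains_between_def by (simp_all add: subset_iff)
    then show False using that by simp
  qed
  have "card (chains_between u v) = (\<Sum>w\<in>{u..<v}. card (insert v ` chains_between u w))"
    unfolding chains_between_decompose[OF assms]
    by (rule card_UN_disjoint) (use fin' finw disj in auto)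
  also have "\<dots> = (\<Sum>w\<in>{u..<v}. card (chains_between u w))"
    by (intro sum.cong refl card_image inj)
  finally show ?thesis .
qed

text \<open>The terms below \<open>v\<close> add up to the count at \<open>v\<close> by the
  recurrence, and \<open>w = v\<close> contributes it once more. This doubling is the origin of the
  powers of 2.\<close>

lemma sum_card_chains_between:
  assumes fin: "finite {u..v}" and "u < v"
  shows "(\<Sum>w\<in>{u..v}. card (chains_between u w)) = 2 * card (chains_between u v)"
proof -
  have fin': "finite {u..<v}" by (rule finite_subset[OF _ fin]) auto
  have "{u..v} = insert v {u..<v}" using \<open>u < v\<close> by auto
  then show ?thesis
    using card_chains_between_rec[OF assms] fin' by simp
qed

lemma sum_card_chains_between_le:
  assumes fin: "finite {u..v}"
  shows "(\<Sum>w\<in>{u..v}. card (chains_between u w)) \<le> 2 * card (chains_between u v)"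
proof -
  consider "u < v" | "u = v" | "\<not> u \<le> v" by force
  then show ?thesis
    by cases (auto simp: sum_card_chains_between fin chains_between_refl)
qed

text \<open>Every element of a chain through \<open>w\<close> is comparable with \<open>w\<close>,
  so the chain is determined by its parts below and above \<open>w\<close>.\<close>

lemma card_chains_through_le:
  assumes fin: "finite {u..v}" and w: "w \<in> {u..v}"
  shows "card {C \<in> chains_between u v. w \<in> C}
           \<le> card (chains_between u w) * card (chains_between w v)"
proof -
  let ?f = "\<lambda>C. (C \<inter> {..w}, C \<inter> {w..})"
  have "inj_on ?f {C \<in> chains_between u v. w \<in> C}"
  proof (rule inj_onI)
    fix C D assume C: "C \<in> {C \<in> chains_between u v. w \<in> C}"
      and D: "D \<in> {C \<in> chains_between u v. w \<in> C}" and eq: "?f C = ?f D"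
    have "C = C \<inter> {..w} \<union> C \<inter> {w..}" "D = D \<inter> {..w} \<union> D \<inter> {w..}"
      using C D by (auto simp: chains_between_def)
    with eq show "C = D" by simp
  qed
  moreover have "?f ` {C \<in> chains_between u v. w \<in> C} \<subseteq> chains_between u w \<times> chains_between w v"
    using w by (auto simp: chains_between_def)
  moreover have "finite (chains_between u w \<times> chains_between w v)"
    using w by (intro finite_cartesian_product finite_chains_between finite_subset[OF _ fin]) auto
  ultimately show ?thesis
    unfolding card_cartesian_product[symmetric] by (rule card_inj_on_le)
qed

section \<open>Growth of the chain counts on the integer grid\<close>

abbreviation num_chains :: "nat \<times> nat \<Rightarrow> nat \<times> nat \<Rightarrow> nat" where
  "num_chains u v \<equiv> card (chains_between u v)"

text \<open>Points not above \<open>u\<close> have count 0, so the row sum may run over all columns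
  \<open>x < p\<close> whatever \<open>u\<close> is.\<close>

lemma num_chains_row:
  "(\<Sum>w\<in>{u..} \<inter> (\<lambda>x. (x, q)) ` {..<p}. num_chains u w) = (\<Sum>x<p. num_chains u (x, q))"
proof -
  have "(\<Sum>w\<in>{u..} \<inter> (\<lambda>x. (x, q)) ` {..<p}. num_chains u w) =
        (\<Sum>w\<in>(\<lambda>x. (x, q)) ` {..<p}. num_chains u w)"
    by (rule sum.mono_neutral_left) (use chains_between_empty in fastforce)+
  also have "\<dots> = (\<Sum>x<p. num_chains u (x, q))"
    by (subst sum.reindex) (auto simp: inj_on_def)
  finally show ?thesis .
qed

text \<open>The predecessors of \<open>(p, Suc q)\<close> are a rectangle with top
  \<open>(p, q)\<close>, to which the doubling identity applies, and the remainder of the top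
  row.\<close>

lemma num_chains_Suc:
  assumes "u < (p, Suc q)"
  shows "num_chains u (p, Suc q) =
           (\<Sum>w\<in>{u..(p, q)}. num_chains u w) + (\<Sum>x<p. num_chains u (x, Suc q))"
proof -
  have "{u..<(p, Suc q)} = {u..(p, q)} \<union> {u..} \<inter> (\<lambda>x. (x, Suc q)) ` {..<p}"
    by (auto simp: less_eq_prod_def less_le_not_le image_iff)
  moreover have "{u..(p, q)} \<inter> ({u..} \<inter> (\<lambda>x. (x, Suc q)) ` {..<p}) = {}"
    by (auto simp: less_eq_prod_def)
  ultimately show ?thesis
    by (simp add: card_chains_between_rec assms sum.union_disjoint num_chains_row)
qed

lemma num_chains_0:
  assumes "u < (p, 0)"
  shows "num_chains u (p, 0) = (\<Sum>x<p. num_chains u (x, 0))"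
proof -
  have "{u..<(p, 0)} = {u..} \<inter> (\<lambda>x. (x, 0)) ` {..<p}"
    by (auto simp: less_eq_prod_def less_le_not_le image_iff)
  then show ?thesis
    by (simp add: card_chains_between_rec assms num_chains_row)
qed

lemma sum_power2_less: "(\<Sum>x<p. 2 ^ x) \<le> (2::nat) ^ p"
  by (induction p) auto

text \<open>Each column after \<open>i\<close> costs at most one factor \<open>q + 1\<close>. The
  factor \<open>2 ^ p\<close> absorbs the row sum, since the powers of 2 below \<open>p\<close> add
  up to at most \<open>2 ^ p\<close>.\<close>

lemma num_chains_le:
  "num_chains (i, j) (p, q) \<le> 2 ^ p * 2 ^ q * (q + 1) ^ (p - i)"
proof (induction q arbitrary: p)
  case 0
  show ?case
  proof (induction p rule: less_induct)
    case (less p)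
    consider "(i, j) < (p, 0)" | "(i, j) = (p, 0)" | "\<not> (i, j) \<le> (p, 0)"
      using order_le_less[of "(i, j)" "(p, 0)"] by blast
    then show ?case
    proof cases
      case 1
      then have "num_chains (i, j) (p, 0) = (\<Sum>x<p. num_chains (i, j) (x, 0))"
        by (rule num_chains_0)
      also have "\<dots> \<le> (\<Sum>x<p. 2 ^ x)" using less by (intro sum_mono) auto
      finally show ?thesis using sum_power2_less[of p] by simp
    qed (auto simp: chains_between_refl chains_between_empty)
  qed
next
  case (Suc q)
  note IHq = Suc.IH
  show ?case
  proof (induction p rule: less_induct)
    case (less p)
    consider "(i, j) < (p, Suc q)" | "(i, j) = (p, Suc q)" | "\<not> (i, j) \<le> (p, Suc q)"
      using order_le_less[of "(i, j)" "(p, Suc q)"] by blast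
    then show ?case
    proof cases
      case 1
      have "(\<Sum>w\<in>{(i, j)..(p, q)}. num_chains (i, j) w) \<le> 2 * num_chains (i, j) (p, q)"
        by (rule sum_card_chains_between_le) simp
      also have "\<dots> \<le> 2 ^ p * 2 ^ Suc q * (q + 1) ^ (p - i)" using IHq[of p] by simp
      finally have A: "(\<Sum>w\<in>{(i, j)..(p, q)}. num_chains (i, j) w) \<le> 2 ^ p * 2 ^ Suc q * (q + 1) ^ (p - i)" .
      have "i \<le> p" using 1 by (simp add: less_le_not_le less_eq_prod_def)
      show ?thesis
      proof (cases "i = p")
        case True
        \<comment> \<open>In the starting column nothing lies to the left, so only the doubling
          remains and no power of \<open>q\<close> arises.\<close>
        have "(\<Sum>x<p. num_chains (i, j) (x, Suc q)) = 0"
          using True by (auto simp: chains_between_empty)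
        then show ?thesis using A num_chains_Suc[OF 1] True by simp
      next
        case False
        \<comment> \<open>Every \<open>x < p\<close> satisfies \<open>x - i \<le> k\<close>, so the
          row sum carries one power less than the main term.\<close>
        define k where "k = p - Suc i"
        have k: "p - i = Suc k" using \<open>i \<le> p\<close> False by (simp add: k_def)
        have "(\<Sum>x<p. num_chains (i, j) (x, Suc q)) \<le> (\<Sum>x<p. 2 ^ x * (2 ^ Suc q * (q + 2) ^ k))"
        proof (rule sum_mono)
          fix x assume "x \<in> {..<p}"
          then have "x < p" by simp
          have "num_chains (i, j) (x, Suc q) \<le> 2 ^ x * 2 ^ Suc q * (Suc q + 1) ^ (x - i)"
            using \<open>x < p\<close> by (rule less.IH)
          also have "\<dots> \<le> 2 ^ x * 2 ^ Suc q * (Suc q + 1) ^ k"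
            using \<open>x < p\<close> by (intro mult_left_mono power_increasing) (auto simp: k_def)
          finally show "num_chains (i, j) (x, Suc q) \<le> 2 ^ x * (2 ^ Suc q * (q + 2) ^ k)"
            by (simp add: mult.assoc)
        qed
        also have "\<dots> \<le> 2 ^ p * (2 ^ Suc q * (q + 2) ^ k)"
          unfolding sum_distrib_right[symmetric]
          by (intro mult_right_mono sum_power2_less) auto
        finally have B: "(\<Sum>x<p. num_chains (i, j) (x, Suc q)) \<le> 2 ^ p * (2 ^ Suc q * (q + 2) ^ k)" .
        \<comment> \<open>Passing from \<open>q\<close> to \<open>q + 1\<close> raises
          \<open>(q + 1) ^ Suc k\<close> by at least \<open>(q + 2) ^ k\<close>, which pays for the
          row sum.\<close>
        have "(q + 1) ^ Suc k \<le> (q + 1) * (q + 2) ^ k"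
          unfolding power_Suc by (intro mult_left_mono power_mono) auto
        then have "(q + 1) ^ Suc k + (q + 2) ^ k \<le> (q + 2) ^ Suc k"
          by simp
        then have C: "2 ^ p * 2 ^ Suc q * ((q + 1) ^ Suc k + (q + 2) ^ k) \<le> 2 ^ p * 2 ^ Suc q * (q + 2) ^ Suc k"
          by (rule mult_left_mono) simp
        have "num_chains (i, j) (p, Suc q) \<le> 2 ^ p * 2 ^ Suc q * ((q + 1) ^ Suc k + (q + 2) ^ k)"
          unfolding num_chains_Suc[OF 1] distrib_left
          using A B unfolding k by (intro add_mono) (simp_all add: mult.assoc)
        also note C
        finally show ?thesis unfolding k by simp
      qed
    qed (auto simp: chains_between_refl chains_between_empty)
  qed
qed

text \<open>The recurrence is weakened to Pascal's rule with weight 2 per row. The factor 2 on the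
  right compensates for the start: in column 0 the count is 1 at both heights 0 and 1 and doubles
  only afterwards.\<close>

lemma num_chains_ge:
  "2 ^ q * (q choose p) \<le> 2 * num_chains (0, 0) (p, q)"
proof (induction q arbitrary: p)
  case 0
  show ?case by (cases p) (auto simp: chains_between_refl)
next
  case (Suc q)
  note IHq = Suc.IH
  have step: "2 * num_chains (0, 0) (p, q) + (\<Sum>x<p. num_chains (0, 0) (x, Suc q))
      = num_chains (0, 0) (p, Suc q)" if "(0, 0) < (p, q)" for p
  proof -
    have "(0, 0) < (p, Suc q)" by (simp add: less_le_not_le less_eq_prod_def)
    then show ?thesis
      using sum_card_chains_between[OF finite_prod_Icc that] by (simp only: num_chains_Suc)
  qed
  show ?case
  proof (induction p)
    case 0
    show ?case
    proof (cases q)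
      case 0
      then show ?thesis using card_chains_between_pos[OF finite_prod_Icc, of "(0, 0)" "(0, Suc 0)"]
        by (simp add: less_eq_prod_def)
    next
      case (Suc q')
      then have "(0, 0) < (0::nat, q)" by (simp add: less_le_not_le less_eq_prod_def)
      from step[OF this] IHq[of 0] show ?thesis by simp
    qed
  next
    case (Suc p)
    have "(0, 0) < (Suc p, q)" by (simp add: less_le_not_le less_eq_prod_def)
    \<comment> \<open>Of the row sum only the last term \<open>x = p\<close> is kept.\<close>
    from step[OF this] have "2 * (2 * num_chains (0, 0) (Suc p, q)) + 2 * num_chains (0, 0) (p, Suc q)
        \<le> 2 * num_chains (0, 0) (Suc p, Suc q)" by simp
    moreover have "2 * (2 ^ q * (q choose Suc p)) \<le> 2 * (2 * num_chains (0, 0) (Suc p, q))"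
      using mult_left_mono[OF IHq[of "Suc p"], of 2] by simp
    moreover have "2 ^ Suc q * (q choose p) \<le> 2 ^ Suc q * (Suc q choose p)"
      by (cases p) simp_all
    moreover have "2 ^ Suc q * (Suc q choose Suc p) =
        2 ^ Suc q * (q choose p) + 2 * (2 ^ q * (q choose Suc p))"
      by (simp add: algebra_simps)
    ultimately show ?case using Suc.IH by linarith
  qed
qed

text \<open>A low chain passes through some w = (i, j) with j < i, hence i \<open>\<ge>\<close> 1, and starting at column i
  instead of column 0 costs a factor (q + 1)\<open>^\<close>i.\<close>

lemma card_low_chains_le:
  fixes k :: nat
  shows "\<exists>K. \<forall>q. q \<ge> k \<longrightarrow>
     (q + 1) * card {C \<in> chains_between (0, 0) (k, q). \<not> (\<forall>e\<in>C. fst e \<le> snd e)}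
       \<le> K * 2 ^ q * (q + 1) ^ k"
proof -
  \<comment> \<open>\<open>W\<close> does not depend on \<open>q\<close>, so summing over it costs
    only a constant. \<open>K\<close> collects the counts below each \<open>w\<close> and the factor
    \<open>2 ^ k\<close> from the bound above \<open>w\<close>.\<close>
  define W where "W = {w \<in> {..k} \<times> {..k}. snd w < fst w}"
  define K where "K = (\<Sum>w\<in>W. num_chains (0, 0) w * 2 ^ k)"
  have finW: "finite W" unfolding W_def by (rule finite_subset[of _ "{..k} \<times> {..k}"]) auto
  have "(q + 1) * card {C \<in> chains_between (0, 0) (k, q). \<not> (\<forall>e\<in>C. fst e \<le> snd e)}
       \<le> K * 2 ^ q * (q + 1) ^ k" if "q \<ge> k" for q
  proof -
    have "{C \<in> chains_between (0, 0) (k, q). \<not> (\<forall>e\<in>C. fst e \<le> snd e)} \<subseteq>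
        (\<Union>w\<in>W. {C \<in> chains_between (0, 0) (k, q). w \<in> C})"
    proof
      fix C assume "C \<in> {C \<in> chains_between (0, 0) (k, q). \<not> (\<forall>e\<in>C. fst e \<le> snd e)}"
      then obtain w where "C \<in> chains_between (0, 0) (k, q)" "w \<in> C" "snd w < fst w"
        by (auto simp: not_le)
      moreover from this have "w \<le> (k, q)" by (auto simp: chains_between_def)
      ultimately have "w \<in> W" by (cases w) (auto simp: W_def)
      then show "C \<in> (\<Union>w\<in>W. {C \<in> chains_between (0, 0) (k, q). w \<in> C})"
        using \<open>C \<in> chains_between (0, 0) (k, q)\<close> \<open>w \<in> C\<close> by blast
    qed
    then have "card {C \<in> chains_between (0, 0) (k, q). \<not> (\<forall>e\<in>C. fst e \<le> snd e)} \<le>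
        card (\<Union>w\<in>W. {C \<in> chains_between (0, 0) (k, q). w \<in> C})"
      using finW by (intro card_mono finite_UN_I finite_Collect_conjI)
        (simp_all add: finite_chains_between)
    also have "\<dots> \<le> (\<Sum>w\<in>W. card {C \<in> chains_between (0, 0) (k, q). w \<in> C})"
      by (rule card_UN_le[OF finW])
    finally have "(q + 1) * card {C \<in> chains_between (0, 0) (k, q). \<not> (\<forall>e\<in>C. fst e \<le> snd e)} \<le>
        (q + 1) * (\<Sum>w\<in>W. card {C \<in> chains_between (0, 0) (k, q). w \<in> C})"
      by (rule mult_left_mono) simp
    also have "\<dots> = (\<Sum>w\<in>W. (q + 1) * card {C \<in> chains_between (0, 0) (k, q). w \<in> C})"
      by (rule sum_distrib_left)
    also have "\<dots> \<le> (\<Sum>w\<in>W. num_chains (0, 0) w * 2 ^ k * (2 ^ q * (q + 1) ^ k))"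
    proof (rule sum_mono)
      fix w assume w: "w \<in> W"
      obtain i j where ij: "w = (i, j)" by force
      have i: "1 \<le> i" "i \<le> k" "j < i" using w ij by (auto simp: W_def)
      have "card {C \<in> chains_between (0, 0) (k, q). w \<in> C} \<le>
          num_chains (0, 0) w * num_chains w (k, q)"
        using i ij that by (intro card_chains_through_le) (auto simp: less_eq_prod_def)
      also have "\<dots> \<le> num_chains (0, 0) w * (2 ^ k * 2 ^ q * (q + 1) ^ (k - i))"
        unfolding ij by (intro mult_left_mono num_chains_le) auto
      \<comment> \<open>Here \<open>i \<ge> 1\<close> enters: a power of \<open>q + 1\<close> is
        saved, which is the extra factor on the left of the claim.\<close>
      also have "\<dots> \<le> num_chains (0, 0) w * (2 ^ k * 2 ^ q * (q + 1) ^ (k - 1))"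
        using i by (intro mult_left_mono power_increasing) auto
      finally have "(q + 1) * card {C \<in> chains_between (0, 0) (k, q). w \<in> C} \<le>
          (q + 1) * (num_chains (0, 0) w * (2 ^ k * 2 ^ q * (q + 1) ^ (k - 1)))"
        by (rule mult_left_mono) simp
      also have "\<dots> = num_chains (0, 0) w * 2 ^ k * (2 ^ q * (q + 1) ^ Suc (k - 1))"
        by (simp only: power_Suc mult_ac)
      finally show "(q + 1) * card {C \<in> chains_between (0, 0) (k, q). w \<in> C} \<le>
          num_chains (0, 0) w * 2 ^ k * (2 ^ q * (q + 1) ^ k)"
        using i by simp
    qed
    also have "\<dots> = K * 2 ^ q * (q + 1) ^ k"
      unfolding K_def sum_distrib_right by (simp add: mult_ac)
    finally show ?thesis .
  qed
  then show ?thesis by blast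
qed

lemma low_chains_negligible:
  fixes k :: nat
  shows "(\<lambda>q. real (card {C \<in> chains_between (0, 0) (k, q). \<not> (\<forall>e\<in>C. fst e \<le> snd e)}) /
              real (num_chains (0, 0) (k, q))) \<longlonglongrightarrow> 0"
proof -
  obtain K where K: "\<And>q. q \<ge> k \<Longrightarrow>
     (q + 1) * card {C \<in> chains_between (0, 0) (k, q). \<not> (\<forall>e\<in>C. fst e \<le> snd e)}
       \<le> K * 2 ^ q * (q + 1) ^ k"
    using card_low_chains_le[of k] by blast
  \<comment> \<open>The factor 2 comes from the lower bound on the chain count, \<open>2 ^ k\<close>
    from \<open>q + 1 \<le> 2 * q\<close>, and \<open>k ^ k\<close> from bounding
    \<open>q choose k\<close> below by the \<open>k\<close>-th power of
    \<open>q / k\<close>.\<close>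
  define M where "M = 2 * real K * 2 ^ k * real k ^ k"
  have bound: "real (card {C \<in> chains_between (0, 0) (k, q). \<not> (\<forall>e\<in>C. fst e \<le> snd e)}) /
              real (num_chains (0, 0) (k, q)) \<le> M * inverse (real (Suc q))" if q: "q \<ge> Suc k" for q
  proof -
    define B where "B = card {C \<in> chains_between (0, 0) (k, q). \<not> (\<forall>e\<in>C. fst e \<le> snd e)}"
    define A where "A = num_chains (0, 0) (k, q)"
    have "1 \<le> A" unfolding A_def by (intro card_chains_between_pos) (auto simp: less_eq_prod_def)
    have 1: "real (q + 1) * real B \<le> real K * 2 ^ q * real (q + 1) ^ k"
    proof -
      have "real ((q + 1) * B) \<le> real (K * 2 ^ q * (q + 1) ^ k)"
        unfolding B_def using q by (intro of_nat_mono K) simp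
      then show ?thesis by (simp only: of_nat_mult of_nat_power of_nat_numeral)
    qed
    have "real q ^ k \<le> real k ^ k * real (q choose k)"
    proof (cases "k = 0")
      case False
      have "(real q / real k) ^ k \<le> real (q choose k)"
        using q by (intro binomial_ge_n_over_k_pow_k) simp
      then show ?thesis using False by (simp add: power_divide divide_le_eq mult.commute)
    qed simp
    moreover have "2 ^ q * real (q choose k) \<le> 2 * real A"
    proof -
      have "real (2 ^ q * (q choose k)) \<le> real (2 * A)"
        unfolding A_def by (intro of_nat_mono num_chains_ge)
      then show ?thesis by simp
    qed
    then have "real k ^ k * (2 ^ q * real (q choose k)) \<le> real k ^ k * (2 * real A)"
      by (rule mult_left_mono) simp
    ultimately have 2: "2 ^ q * real q ^ k \<le> real k ^ k * (2 * real A)"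
      by (smt (verit, ccfv_SIG) mult.left_commute mult_left_mono zero_le_power)
    have "real (q + 1) ^ k \<le> (2 * real q) ^ k"
      using q by (intro power_mono) auto
    then have "real K * 2 ^ q * real (q + 1) ^ k \<le> real K * 2 ^ q * (2 * real q) ^ k"
      by (rule mult_left_mono) simp
    also have "\<dots> = real K * 2 ^ k * (2 ^ q * real q ^ k)"
      by (simp add: power_mult_distrib)
    also have "\<dots> \<le> real K * 2 ^ k * (real k ^ k * (2 * real A))"
      by (intro mult_left_mono 2) simp
    also have "\<dots> = M * real A" by (simp add: M_def)
    finally have "real (q + 1) * real B \<le> M * real A" using 1 by linarith
    then show ?thesis using \<open>1 \<le> A\<close>
      unfolding A_def[symmetric] B_def[symmetric]
      by (simp add: field_simps)
  qed
  show ?thesis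
  proof (rule Lim_null_comparison)
    show "(\<lambda>q. M * inverse (real (Suc q))) \<longlonglongrightarrow> 0"
      by (rule tendsto_mult_right_zero[OF LIMSEQ_inverse_real_of_nat])
    show "\<forall>\<^sub>F q in sequentially.
        norm (real (card {C \<in> chains_between (0, 0) (k, q). \<not> (\<forall>e\<in>C. fst e \<le> snd e)}) /
              real (num_chains (0, 0) (k, q))) \<le> M * inverse (real (Suc q))"
      using bound by (auto simp: eventually_sequentially)
  qed
qed

section \<open>Lattice trapezoids\<close>

text \<open>The pair (i, j) encodes the segment from (i, 0) to (j, 1), and \<open>xpos\<close> is its abscissa at
  height t. Since \<open>trap e e'\<close> is cut out by two such segments, it may degenerate to a triangle, and
  \<open>trap e e\<close> is the segment itself.\<close>

definition xpos :: "nat \<times> nat \<Rightarrow> real \<Rightarrow> real" where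
  "xpos e t = (1 - t) * real (fst e) + t * real (snd e)"

definition trap :: "nat \<times> nat \<Rightarrow> nat \<times> nat \<Rightarrow> point set" where
  "trap e e' = {z. 0 \<le> snd z \<and> snd z \<le> 1 \<and> xpos e (snd z) \<le> fst z \<and> fst z \<le> xpos e' (snd z)}"

definition corners :: "nat \<times> nat \<Rightarrow> nat \<times> nat \<Rightarrow> point set" where
  "corners e e' = {(real (fst e), 0), (real (snd e), 1), (real (fst e'), 0), (real (snd e'), 1)}"

lemma xpos_0 [simp]: "xpos e 0 = real (fst e)" and xpos_1 [simp]: "xpos e 1 = real (snd e)"
  by (simp_all add: xpos_def)

lemma xpos_mono: "e \<le> e' \<Longrightarrow> 0 \<le> t \<Longrightarrow> t \<le> 1 \<Longrightarrow> xpos e t \<le> xpos e' t"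
  unfolding xpos_def less_eq_prod_def by (intro add_mono mult_left_mono) auto

lemma xpos_strict_mono:
  assumes "e < e'" "0 < t" "t < 1"
  shows "xpos e t < xpos e' t"
proof -
  have "fst e < fst e' \<and> snd e \<le> snd e' \<or> fst e \<le> fst e' \<and> snd e < snd e'"
    using assms(1) by (auto simp: less_le_not_le less_eq_prod_def)
  then show ?thesis
  proof (elim disjE conjE)
    assume "fst e < fst e'" "snd e \<le> snd e'"
    then show ?thesis
      unfolding xpos_def using assms by (intro add_less_le_mono mult_left_mono mult_strict_left_mono) auto
  next
    assume "fst e \<le> fst e'" "snd e < snd e'"
    then show ?thesis
      unfolding xpos_def using assms by (intro add_le_less_mono mult_left_mono mult_strict_left_mono) auto
  qed
qed

lemma xpos_affine: "u + v = 1 \<Longrightarrow> xpos e (u * s + v * t) = u * xpos e s + v * xpos e t"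
proof -
  assume "u + v = 1"
  then have "v = 1 - u" by simp
  show ?thesis unfolding \<open>v = 1 - u\<close> xpos_def by (simp add: algebra_simps)
qed

lemma continuous_on_xpos [continuous_intros]:
  "continuous_on S f \<Longrightarrow> continuous_on S (\<lambda>z. xpos e (f z))"
  unfolding xpos_def by (intro continuous_intros)

lemma convex_trap: "convex (trap e e')"
proof (rule convexI)
  fix x y :: point and u v :: real
  assume x: "x \<in> trap e e'" and y: "y \<in> trap e e'" and uv: "0 \<le> u" "0 \<le> v" "u + v = 1"
  have "u * snd x + v * snd y \<le> u * 1 + v * 1"
    using x y uv by (intro add_mono mult_left_mono) (auto simp: trap_def)
  moreover have "u * xpos e (snd x) + v * xpos e (snd y) \<le> u * fst x + v * fst y"
    using x y uv by (intro add_mono mult_left_mono) (auto simp: trap_def)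
  moreover have "u * fst x + v * fst y \<le> u * xpos e' (snd x) + v * xpos e' (snd y)"
    using x y uv by (intro add_mono mult_left_mono) (auto simp: trap_def)
  moreover have "0 \<le> u * snd x + v * snd y"
    using x y uv by (intro add_nonneg_nonneg mult_nonneg_nonneg) (auto simp: trap_def)
  ultimately show "u *\<^sub>R x + v *\<^sub>R y \<in> trap e e'"
    using uv by (simp add: trap_def xpos_affine)
qed

lemma corners_subset_trap: "e \<le> e' \<Longrightarrow> corners e e' \<subseteq> trap e e'"
  by (auto simp: corners_def trap_def less_eq_prod_def)

lemma xpos_point_in_segment:
  assumes "0 \<le> t" "t \<le> 1"
  shows "(xpos e t, t) \<in> closed_segment (real (fst e), 0) (real (snd e), 1)"
  unfolding in_segment using assms by (intro exI[of _ t]) (simp add: xpos_def)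

text \<open>A point of the region lies on the horizontal chord at its height, and the ends of that
  chord lie on the two bounding segments, whose endpoints are corners.\<close>

lemma trap_eq_hull:
  assumes "e \<le> e'"
  shows "trap e e' = convex hull (corners e e')"
proof
  show "convex hull (corners e e') \<subseteq> trap e e'"
    by (rule hull_minimal[where S = convex]) (auto simp: convex_trap corners_subset_trap[OF assms])
next
  show "trap e e' \<subseteq> convex hull (corners e e')"
  proof
    fix z assume "z \<in> trap e e'"
    then obtain x t where z: "z = (x, t)" and t: "0 \<le> t" "t \<le> 1"
      and x: "xpos e t \<le> x" "x \<le> xpos e' t"
      by (cases z) (auto simp: trap_def)
    have seg: "closed_segment (real (fst d), 0) (real (snd d), 1) \<subseteq> convex hull (corners e e')"
      if "d = e \<or> d = e'" for d
      using that by (intro closed_segment_subset hull_inc) (auto simp: corners_def)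
    have "x \<in> closed_segment (xpos e t) (xpos e' t)"
      using x by (simp add: closed_segment_eq_real_ivl)
    then obtain u where u: "0 \<le> u" "u \<le> 1" "x = (1 - u) * xpos e t + u * xpos e' t"
      unfolding in_segment by auto
    then have "z \<in> closed_segment (xpos e t, t) (xpos e' t, t)"
      unfolding in_segment z by (intro exI[of _ u]) (auto simp: algebra_simps)
    also have "\<dots> \<subseteq> convex hull (corners e e')"
      using seg[of e] seg[of e'] xpos_point_in_segment[OF t, of e] xpos_point_in_segment[OF t, of e']
      by (intro closed_segment_subset convex_convex_hull) blast+
    finally show "z \<in> convex hull (corners e e')" .
  qed
qed

lemma trap_self: "trap e e = closed_segment (real (fst e), 0) (real (snd e), 1)"
  by (simp add: trap_eq_hull corners_def segment_convex_hull insert_commute)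

text \<open>At heights 0 and 1 the region is the interval between its corners, so mutual inclusion
  of the corners gives inequalities in both directions.\<close>

lemma trap_inject:
  assumes "e1 \<le> e1'" "e2 \<le> e2'" "trap e1 e1' = trap e2 e2'"
  shows "e1 = e2 \<and> e1' = e2'"
proof -
  have "corners e1 e1' \<subseteq> trap e2 e2'" "corners e2 e2' \<subseteq> trap e1 e1'"
    using assms corners_subset_trap by metis+
  then show ?thesis
    by (auto simp: corners_def trap_def prod_eq_iff)
qed

section \<open>Faces, corners and interior of a trapezoid\<close>

text \<open>The line through (i, 0) and (j, 1) has normal vector (1, i - j); in inner product form
  the facts on supporting hyperplanes apply to it.\<close>

lemma xpos_hyperplane:
  "fst z = xpos e (snd z) \<longleftrightarrow> (1, real (fst e) - real (snd e)) \<bullet> z = real (fst e)"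
  "xpos e (snd z) \<le> fst z \<longleftrightarrow> real (fst e) \<le> (1, real (fst e) - real (snd e)) \<bullet> z"
  "fst z \<le> xpos e (snd z) \<longleftrightarrow> (1, real (fst e) - real (snd e)) \<bullet> z \<le> real (fst e)"
  by (auto simp: xpos_def inner_prod_def algebra_simps)

lemma trap_left_face: "e \<le> e' \<Longrightarrow> trap e e face_of trap e e'"
proof -
  assume "e \<le> e'"
  then have eq: "trap e e = trap e e' \<inter> {z. (1, real (fst e) - real (snd e)) \<bullet> z = real (fst e)}"
    using xpos_mono[of e e'] by (auto simp: trap_def simp flip: xpos_hyperplane)
  show ?thesis
    unfolding eq by (rule face_of_Int_supporting_hyperplane_ge[OF convex_trap])
      (simp add: trap_def flip: xpos_hyperplane)
qed

lemma trap_right_face: "e \<le> e' \<Longrightarrow> trap e' e' face_of trap e e'"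
proof -
  assume "e \<le> e'"
  then have eq: "trap e' e' = trap e e' \<inter> {z. (1, real (fst e') - real (snd e')) \<bullet> z = real (fst e')}"
    using xpos_mono[of e e'] by (auto simp: trap_def simp flip: xpos_hyperplane)
  show ?thesis
    unfolding eq by (rule face_of_Int_supporting_hyperplane_le[OF convex_trap])
      (simp add: trap_def flip: xpos_hyperplane)
qed

lemma trap_self_extreme:
  "(real (fst e), 0) extreme_point_of trap e e" "(real (snd e), 1) extreme_point_of trap e e"
  by (simp_all add: trap_self extreme_point_of_segment)

text \<open>Each corner is an end of the left or right bounding segment, and an extreme point of a
  face is extreme in the whole set.\<close>

lemma trap_corner_extreme:
  assumes "e \<le> e'" "v \<in> corners e e'"
  shows "v extreme_point_of trap e e'"
  using assms(2) trap_self_extreme[of e] trap_self_extreme[of e']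
  by (auto simp: corners_def extreme_point_of_face[OF trap_left_face[OF assms(1)]]
      extreme_point_of_face[OF trap_right_face[OF assms(1)]])

lemma extreme_point_of_trap:
  "e \<le> e' \<Longrightarrow> v extreme_point_of trap e e' \<Longrightarrow> v \<in> corners e e'"
  by (simp add: trap_eq_hull extreme_point_of_convex_hull)

lemma aff_dim_trap_self: "aff_dim (trap e e) = 1"
  by (simp add: trap_self segment_convex_hull aff_dim_convex_hull)

text \<open>Strict inequalities at a single height suffice: they leave room for a point there, and
  the strict versions of all constraints cut out an open set.\<close>

lemma interior_trap_Int_nonempty:
  assumes t: "0 < t" "t < 1"
    and "xpos e1 t < xpos e1' t" "xpos e1 t < xpos e2' t" "xpos e2 t < xpos e1' t" "xpos e2 t < xpos e2' t"
  shows "interior (trap e1 e1' \<inter> trap e2 e2') \<noteq> {}"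
proof -
  define U :: "point set" where "U = {z. 0 < snd z} \<inter> {z. snd z < 1}
     \<inter> {z. xpos e1 (snd z) < fst z} \<inter> {z. xpos e2 (snd z) < fst z}
     \<inter> {z. fst z < xpos e1' (snd z)} \<inter> {z. fst z < xpos e2' (snd z)}"
  have "open U" unfolding U_def
    by (intro open_Int open_Collect_less continuous_intros)
  moreover have "U \<subseteq> trap e1 e1' \<inter> trap e2 e2'" by (auto simp: U_def trap_def)
  ultimately have "U \<subseteq> interior (trap e1 e1' \<inter> trap e2 e2')" by (rule interior_maximal[rotated])
  moreover obtain x where "max (xpos e1 t) (xpos e2 t) < x" "x < min (xpos e1' t) (xpos e2' t)"
    using dense[of "max (xpos e1 t) (xpos e2 t)" "min (xpos e1' t) (xpos e2' t)"] assms by auto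
  then have "(x, t) \<in> U" using t by (simp add: U_def)
  ultimately show ?thesis by blast
qed

lemma convex_polygon_trap:
  assumes "e < e'"
  shows "convex_polygon (trap e e')"
proof -
  have "polytope (trap e e')"
    using assms by (simp add: trap_eq_hull less_imp_le polytope_convex_hull corners_def)
  moreover have "interior (trap e e' \<inter> trap e e') \<noteq> {}"
    using xpos_strict_mono[OF assms, of "1/2"] by (intro interior_trap_Int_nonempty[of "1/2"]) auto
  ultimately show ?thesis by (simp add: convex_polygon_def)
qed

lemma interior_trap_self: "interior (trap e e) = {}"
proof -
  have "trap e e \<subseteq> {z. (1, real (fst e) - real (snd e)) \<bullet> z = real (fst e)}"
    by (auto simp: trap_def simp flip: xpos_hyperplane)
  moreover have "interior {z :: point. (1, real (fst e) - real (snd e)) \<bullet> z = real (fst e)} = {}"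
    by (rule interior_hyperplane) (simp add: prod_eq_iff)
  ultimately show ?thesis using interior_mono by blast
qed

lemma convex_hull_grid:
  assumes "m \<ge> 1" "n \<ge> 1"
  shows "convex hull (grid m n) = trap (0, 0) (n - 1, m - 1)"
proof
  have *: "(0, 0) \<le> (n - 1, m - 1)" by (simp add: less_eq_prod_def)
  show "convex hull (grid m n) \<subseteq> trap (0, 0) (n - 1, m - 1)"
    by (rule hull_minimal[where S = convex, OF _ convex_trap]) (auto simp: grid_def trap_def xpos_def)
  have "corners (0, 0) (n - 1, m - 1) \<subseteq> grid m n"
    using assms by (auto simp: corners_def grid_def simp del: of_nat_diff)
  then show "trap (0, 0) (n - 1, m - 1) \<subseteq> convex hull (grid m n)"
    unfolding trap_eq_hull[OF *] by (rule hull_mono)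
qed

text \<open>By Krein-Milman a polygon is the hull of its vertices. These meet both rows, since
  otherwise the interior would be empty, and the leftmost and rightmost vertex of each row already
  span the hull.\<close>

lemma polygon_in_grid_is_trap:
  assumes poly: "convex_polygon Q" and grid: "{v. v extreme_point_of Q} \<subseteq> grid m n"
  obtains e e' where "e < e'" "e' \<le> (n - 1, m - 1)" "Q = trap e e'"
proof -
  define V where "V = {v. v extreme_point_of Q}"
  have "compact Q" "convex Q" "interior Q \<noteq> {}"
    using poly by (auto simp: convex_polygon_def polytope_imp_compact polytope_imp_convex)
  then have Q: "Q = convex hull V" unfolding V_def by (intro Krein_Milman_Minkowski)
  define I where "I = {i. (real i, 0) \<in> V}"
  define J where "J = {j. (real j, 1) \<in> V}"
  have V: "V \<subseteq> grid m n" using grid by (simp add: V_def)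
  have IJ: "I \<subseteq> {..<n}" "J \<subseteq> {..<m}"
    using V by (auto simp: I_def J_def grid_def)
  have fin: "finite I" "finite J" using IJ by (auto intro: finite_subset)
  have level: "\<not> V \<subseteq> {z. snd z = c}" for c
  proof
    assume "V \<subseteq> {z. snd z = c}"
    moreover have *: "{z. snd z = c} = {z :: point. (0, 1) \<bullet> z = c}" by (auto simp: inner_prod_def)
    ultimately have "Q \<subseteq> {z :: point. (0, 1) \<bullet> z = c}"
      unfolding Q by (intro hull_minimal[where S = convex]) (auto simp: convex_hyperplane)
    moreover have "interior {z :: point. (0, 1) \<bullet> z = c} = {}"
      by (rule interior_hyperplane) (simp add: prod_eq_iff)
    ultimately show False using \<open>interior Q \<noteq> {}\<close> interior_mono by blast
  qed
  have ne: "I \<noteq> {}" "J \<noteq> {}"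
    using level[of 1] level[of 0] V by (force simp: I_def J_def grid_def)+
  define e where "e = (Min I, Min J)"
  define e' where "e' = (Max I, Max J)"
  have le: "e \<le> e'" using fin ne by (simp add: e_def e'_def less_eq_prod_def)
  have "V \<subseteq> trap e e'"
  proof
    fix v assume v: "v \<in> V"
    then consider i where "v = (real i, 0)" "i \<in> I" | j where "v = (real j, 1)" "j \<in> J"
      using V by (auto simp: I_def J_def grid_def)
    then show "v \<in> trap e e'"
      using fin by cases (auto simp: trap_def e_def e'_def)
  qed
  then have "Q \<subseteq> trap e e'" unfolding Q by (intro hull_minimal[where S = convex] convex_trap)
  moreover have "corners e e' \<subseteq> V"
    using Min_in[OF fin(1) ne(1)] Min_in[OF fin(2) ne(2)] Max_in[OF fin(1) ne(1)] Max_in[OF fin(2) ne(2)]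
    by (auto simp: corners_def e_def e'_def I_def J_def)
  then have "trap e e' \<subseteq> Q" unfolding Q trap_eq_hull[OF le] by (rule hull_mono)
  ultimately have "Q = trap e e'" by blast
  moreover have "e \<noteq> e'" using \<open>interior Q \<noteq> {}\<close> interior_trap_self \<open>Q = trap e e'\<close> by metis
  then have "e < e'" using le by simp
  moreover have "e' \<le> (n - 1, m - 1)"
    using Max_in[OF fin(1) ne(1)] Max_in[OF fin(2) ne(2)] IJ by (auto simp: e'_def less_eq_prod_def)
  ultimately show ?thesis using that by blast
qed

section \<open>Overlap of two trapezoids\<close>

lemma affine_pair_pos_near_0:
  fixes a b c d :: real
  assumes "0 < a" "0 < c"
  shows "\<exists>t. 0 < t \<and> t < 1 \<and> 0 < (1 - t) * a + t * b \<and> 0 < (1 - t) * c + t * d"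
proof -
  have "((\<lambda>t. (1 - t) * a + t * b) \<longlongrightarrow> (1 - 0) * a + 0 * b) (at_right 0)"
       "((\<lambda>t. (1 - t) * c + t * d) \<longlongrightarrow> (1 - 0) * c + 0 * d) (at_right 0)"
    by (intro tendsto_intros)+
  then have "\<forall>\<^sub>F t in at_right 0. 0 < (1 - t) * a + t * b" "\<forall>\<^sub>F t in at_right 0. 0 < (1 - t) * c + t * d"
    using assms by (auto dest: order_tendstoD(1))
  moreover have "\<forall>\<^sub>F t in at_right 0. t \<in> {0<..<1::real}"
    by (rule eventually_at_right_real) simp
  ultimately have "\<forall>\<^sub>F t in at_right 0. 0 < t \<and> t < 1 \<and> 0 < (1 - t) * a + t * b \<and> 0 < (1 - t) * c + t * d"
    by eventually_elim auto
  then show ?thesis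
    using eventually_happens trivial_limit_at_right_real by blast
qed

text \<open>If the two functions are positive at opposite ends only, they agree at an interior point, and
  there their sum is positive.\<close>

lemma affine_pair_pos:
  fixes a b c d :: real
  assumes "0 < a \<or> 0 < b" "0 < c \<or> 0 < d" "0 \<le> a + c" "0 \<le> b + d" "0 < a + c \<or> 0 < b + d"
  shows "\<exists>t. 0 < t \<and> t < 1 \<and> 0 < (1 - t) * a + t * b \<and> 0 < (1 - t) * c + t * d"
proof -
  have cross: "\<exists>t. 0 < t \<and> t < 1 \<and> 0 < (1 - t) * a + t * b \<and> 0 < (1 - t) * c + t * d"
    if *: "0 < a" "c \<le> 0" "b \<le> 0" "0 < d" "0 \<le> a + c" "0 \<le> b + d" "0 < a + c \<or> 0 < b + d" for a b c d :: real
  proof -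
    \<comment> \<open>The abscissa where the graphs of the two affine functions cross.\<close>
    define t where "t = (a - c) / ((a - c) + (d - b))"
    have t: "0 < t" "t < 1" using * by (auto simp: t_def field_simps)
    have eq: "(1 - t) * a + t * b = (1 - t) * c + t * d"
      using * by (simp add: t_def field_simps)
    have "0 < (1 - t) * (a + c) + t * (b + d)"
      using *(7)
    proof
      assume "0 < a + c"
      then show ?thesis using t * by (intro add_pos_nonneg) auto
    next
      assume "0 < b + d"
      then show ?thesis using t * by (intro add_nonneg_pos) auto
    qed
    then have "0 < ((1 - t) * a + t * b) + ((1 - t) * c + t * d)"
      by (simp add: algebra_simps)
    then show ?thesis using eq t by (intro exI[of _ t]) linarith
  qed
  consider "0 < a" "0 < c" | "0 < b" "0 < d" | "0 < a" "c \<le> 0" "b \<le> 0" "0 < d"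
    | "0 < c" "a \<le> 0" "d \<le> 0" "0 < b"
    using assms(1,2) by linarith
  then show ?thesis
  proof cases
    case 1
    then show ?thesis by (rule affine_pair_pos_near_0)
  next
    case 2
    then obtain t where "0 < t" "t < 1" "0 < (1 - t) * b + t * a" "0 < (1 - t) * d + t * c"
      using affine_pair_pos_near_0 by blast
    then show ?thesis by (intro exI[of _ "1 - t"]) (simp add: add.commute)
  next
    case 3
    then show ?thesis using assms by (intro cross) auto
  next
    case 4
    then have "\<exists>t. 0 < t \<and> t < 1 \<and> 0 < (1 - t) * c + t * d \<and> 0 < (1 - t) * a + t * b"
      using assms by (intro cross) auto
    then show ?thesis by blast
  qed
qed

text \<open>The regions overlap at height t if each left side is strictly left of the other's right
  side. These two gaps are affine in t; their sum is the total width, nonnegative at both ends and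
  positive at one of them. If the order fails both ways, each gap is positive at some end.\<close>

lemma trap_noncrossing:
  assumes lt: "e1 < e1'" "e2 < e2'" and int: "interior (trap e1 e1' \<inter> trap e2 e2') = {}"
  shows "e1' \<le> e2 \<or> e2' \<le> e1"
proof (rule ccontr)
  assume not: "\<not> (e1' \<le> e2 \<or> e2' \<le> e1)"
  define a b where "a = real (fst e2') - real (fst e1)" and "b = real (snd e2') - real (snd e1)"
  define c d where "c = real (fst e1') - real (fst e2)" and "d = real (snd e1') - real (snd e2)"
  have "\<exists>t. 0 < t \<and> t < 1 \<and> 0 < (1 - t) * a + t * b \<and> 0 < (1 - t) * c + t * d"
    using lt not by (intro affine_pair_pos) (auto simp: a_def b_def c_def d_def less_le_not_le less_eq_prod_def)
  then obtain t where t: "0 < t" "t < 1" "0 < (1 - t) * a + t * b" "0 < (1 - t) * c + t * d"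
    by blast
  then have "xpos e1 t < xpos e2' t" "xpos e2 t < xpos e1' t"
    by (auto simp: xpos_def a_def b_def c_def d_def algebra_simps)
  then have "interior (trap e1 e1' \<inter> trap e2 e2') \<noteq> {}"
    using lt t xpos_strict_mono by (intro interior_trap_Int_nonempty[of t]) auto
  then show False using int by simp
qed

section \<open>Subdivisions of the two-row grid\<close>

text \<open>The covering relation of the order restricted to \<open>C\<close>.\<close>

definition consecutive :: "(nat \<times> nat) set \<Rightarrow> ((nat \<times> nat) \<times> (nat \<times> nat)) set" where
  "consecutive C = {(e, e'). e \<in> C \<and> e' \<in> C \<and> e < e' \<and> (\<forall>d\<in>C. \<not> (e < d \<and> d < e'))}"

definition chain_subdivision :: "(nat \<times> nat) set \<Rightarrow> point set set" where
  "chain_subdivision C = (\<lambda>(e, e'). trap e e') ` consecutive C"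

lemma finite_chain: "C \<in> chains_between u v \<Longrightarrow> finite (C :: (nat \<times> nat) set)"
  by (rule finite_subset[of _ "{u..v}"]) (simp_all add: chains_between_def)

lemma chain_comparable: "C \<in> chains_between u v \<Longrightarrow> x \<in> C \<Longrightarrow> y \<in> C \<Longrightarrow> x \<le> y \<or> y < x"
  unfolding chains_between_def by (auto simp: order_le_less)

lemma chain_bounds: "C \<in> chains_between u v \<Longrightarrow> x \<in> C \<Longrightarrow> u \<le> x \<and> x \<le> v"
  unfolding chains_between_def by auto

lemma chain_ends: "C \<in> chains_between u v \<Longrightarrow> u \<in> C \<and> v \<in> C"
  unfolding chains_between_def by auto

lemma consecutive_successor:
  assumes C: "C \<in> chains_between u v" and e: "e \<in> C" "e \<noteq> v"
  shows "\<exists>e'. (e, e') \<in> consecutive C"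
proof -
  have "e < v" using chain_bounds[OF C e(1)] e(2) by (metis order_le_less)
  then have "finite {d \<in> C. e < d}" "{d \<in> C. e < d} \<noteq> {}"
    using finite_chain[OF C] chain_ends[OF C] by (simp, blast)
  then obtain e' where "e' \<in> {d \<in> C. e < d}" and min: "\<forall>d\<in>{d \<in> C. e < d}. d \<le> e' \<longrightarrow> e' = d"
    using finite_has_minimal[of "{d \<in> C. e < d}"] by blast
  moreover have "\<not> (e < d \<and> d < e')" if "d \<in> C" for d
  proof
    assume "e < d \<and> d < e'"
    then have "e' = d" using min that by (blast intro: less_imp_le)
    then show False using \<open>e < d \<and> d < e'\<close> by simp
  qed
  ultimately have "(e, e') \<in> consecutive C"
    using e by (simp add: consecutive_def)
  then show ?thesis ..
qed

lemma consecutive_disjoint: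
  assumes C: "C \<in> chains_between u v"
    and "(e1, e1') \<in> consecutive C" "(e2, e2') \<in> consecutive C" "(e1, e1') \<noteq> (e2, e2')"
  shows "e1' \<le> e2 \<or> e2' \<le> e1"
proof -
  have c1: "e1 \<in> C" "e1' \<in> C" "e1 < e1'" "\<And>d. d \<in> C \<Longrightarrow> e1 < d \<Longrightarrow> \<not> d < e1'"
    and c2: "e2 \<in> C" "e2' \<in> C" "e2 < e2'" "\<And>d. d \<in> C \<Longrightarrow> e2 < d \<Longrightarrow> \<not> d < e2'"
    using assms(2,3) by (auto simp: consecutive_def)
  consider "e1 < e2" | "e2 < e1" | "e1 = e2"
    using chain_comparable[OF C c1(1) c2(1)] order_le_less by blast
  then show ?thesis
  proof cases
    case 1
    then show ?thesis using chain_comparable[OF C c1(2) c2(1)] c1(4)[OF c2(1)] by blast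
  next
    case 2
    then show ?thesis using chain_comparable[OF C c2(2) c1(1)] c2(4)[OF c1(1)] by blast
  next
    case 3
    then have "\<not> e1' < e2'" "\<not> e2' < e1'"
      using c1(2-4) c2(2-4) by blast+
    then have "e1' = e2'"
      using chain_comparable[OF C c1(2) c2(2)] order_le_less by blast
    then show ?thesis using 3 assms(4) by simp
  qed
qed

text \<open>A common point lies on both \<open>e1'\<close> and \<open>e2\<close>. If these differ,
  they are strictly apart at inner heights, so contact is possible only in one row, at a shared
  corner; contact in both rows would make them equal.\<close>

lemma trap_Int_conforming:
  assumes "e1 < e1'" "e1' \<le> e2" "e2 < e2'"
  defines "F \<equiv> trap e1 e1' \<inter> trap e2 e2'"
  shows "F = {} \<or>
    (\<exists>v. F = {v} \<and> v extreme_point_of trap e1 e1' \<and> v extreme_point_of trap e2 e2') \<or>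
    (F edge_of trap e1 e1' \<and> F edge_of trap e2 e2')"
proof (cases "e1' = e2")
  case True
  have "F = trap e2 e2"
    unfolding F_def True using xpos_mono[of e1 e2] xpos_mono[of e2 e2'] assms True
    by (auto simp: trap_def less_imp_le intro: order.trans)
  then show ?thesis
    using trap_right_face[of e1 e1'] trap_left_face[of e2 e2'] assms True
    by (simp add: edge_of_def aff_dim_trap_self)
next
  case False
  then have lt: "e1' < e2" using assms(2) by simp
  have eq: "xpos e1' (snd z) = fst z \<and> xpos e2 (snd z) = fst z \<and> (snd z = 0 \<or> snd z = 1)" if "z \<in> F" for z
  proof -
    have z: "0 \<le> snd z" "snd z \<le> 1" "xpos e2 (snd z) \<le> fst z" "fst z \<le> xpos e1' (snd z)"
      using that by (auto simp: F_def trap_def)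
    then show ?thesis
      using xpos_mono[OF assms(2), of "snd z"] xpos_strict_mono[OF lt, of "snd z"] by linarith
  qed
  have corner: "F = {v} \<and> v extreme_point_of trap e1 e1' \<and> v extreme_point_of trap e2 e2'"
    if "v \<in> corners e1 e1'" "v \<in> corners e2 e2'" "F \<subseteq> {v}" for v
    using that assms trap_corner_extreme[of e1 e1' v] trap_corner_extreme[of e2 e2' v]
      corners_subset_trap[of e1 e1'] corners_subset_trap[of e2 e2']
    by (auto simp: F_def less_imp_le)
  consider "fst e1' = fst e2" "snd e1' \<noteq> snd e2" | "snd e1' = snd e2" "fst e1' \<noteq> fst e2"
    | "fst e1' \<noteq> fst e2" "snd e1' \<noteq> snd e2"
    using False by (auto simp: prod_eq_iff)
  then show ?thesis
  proof cases
    case 1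
    have "F \<subseteq> {(real (fst e2), 0)}" using eq 1 by (force simp: prod_eq_iff)
    then show ?thesis using corner[of "(real (fst e2), 0)"] 1 by (auto simp: corners_def)
  next
    case 2
    have "F \<subseteq> {(real (snd e2), 1)}" using eq 2 by (force simp: prod_eq_iff)
    then show ?thesis using corner[of "(real (snd e2), 1)"] 2 by (auto simp: corners_def)
  next
    case 3
    have "F = {}" using eq 3 by force
    then show ?thesis by simp
  qed
qed

lemma chain_subdivision_covers:
  assumes C: "C \<in> chains_between u v" and "u < v"
  shows "\<Union> (chain_subdivision C) = trap u v"
proof
  show "\<Union> (chain_subdivision C) \<subseteq> trap u v"
  proof
    fix z assume "z \<in> \<Union> (chain_subdivision C)"
    then obtain e e' where e: "e \<in> C" "e' \<in> C" "z \<in> trap e e'"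
      by (auto simp: chain_subdivision_def consecutive_def)
    have "xpos u (snd z) \<le> xpos e (snd z)" "xpos e' (snd z) \<le> xpos v (snd z)"
      using e chain_bounds[OF C e(1)] chain_bounds[OF C e(2)]
      by (auto intro!: xpos_mono simp: trap_def)
    then show "z \<in> trap u v" using e(3) by (auto simp: trap_def)
  qed
next
  show "trap u v \<subseteq> \<Union> (chain_subdivision C)"
  proof
    fix z assume z: "z \<in> trap u v"
    \<comment> \<open>The polygon containing \<open>z\<close> starts at the last chain element left
      of \<open>z\<close>. Excluding \<open>v\<close> guarantees a successor; if that successor is
      \<open>v\<close> itself, \<open>z\<close> lies left of it by assumption.\<close>
    define D where "D = {e \<in> C. e \<noteq> v \<and> xpos e (snd z) \<le> fst z}"
    have "finite D" "u \<in> D"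
      using finite_chain[OF C] chain_ends[OF C] \<open>u < v\<close> z by (auto simp: D_def trap_def)
    then obtain e where e: "e \<in> D" "\<And>d. d \<in> D \<Longrightarrow> e \<le> d \<Longrightarrow> e = d"
      using finite_has_maximal[of D] by blast
    then obtain e' where e': "(e, e') \<in> consecutive C"
      using consecutive_successor[OF C, of e] by (force simp: D_def)
    then have "e < e'" "e' \<in> C" by (auto simp: consecutive_def)
    then have "e' \<notin> D" using e(2)[of e'] by (auto simp: order_less_le)
    then have "fst z \<le> xpos e' (snd z)"
      using \<open>e' \<in> C\<close> z by (auto simp: D_def trap_def)
    then have "z \<in> trap e e'" using e(1) z by (auto simp: D_def trap_def)
    then show "z \<in> \<Union> (chain_subdivision C)"
      using e' by (auto simp: chain_subdivision_def)
  qed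
qed

lemma subdivision_chain_subdivision:
  assumes C: "C \<in> chains_between (0, 0) (n - 1, m - 1)" and mn: "m \<ge> 2" "n \<ge> 1"
  shows "subdivision (grid m n) (chain_subdivision C)"
  unfolding subdivision_def
proof (intro conjI ballI impI)
  \<comment> \<open>This is where \<open>m \<ge> 2\<close> enters: the ends of the chain differ and
    the hull is two-dimensional.\<close>
  have lt: "(0, 0) < (n - 1, m - 1)" using mn by (auto simp: less_le_not_le less_eq_prod_def)
  show "\<Union> (chain_subdivision C) = convex hull (grid m n)"
    using chain_subdivision_covers[OF C lt] mn by (simp add: convex_hull_grid)
  fix Q assume "Q \<in> chain_subdivision C"
  then obtain e e' where Q: "Q = trap e e'" "(e, e') \<in> consecutive C"
    by (auto simp: chain_subdivision_def)
  then have e: "e \<in> C" "e' \<in> C" "e < e'" by (auto simp: consecutive_def)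
  then show "convex_polygon Q" using Q by (simp add: convex_polygon_trap)
  have "corners e e' \<subseteq> grid m n"
    using chain_bounds[OF C e(1)] chain_bounds[OF C e(2)] mn
    by (auto simp: corners_def grid_def less_eq_prod_def)
  then show "{v. v extreme_point_of Q} \<subseteq> grid m n"
    using extreme_point_of_trap[of e e'] e Q by (auto simp: less_imp_le)
  fix R assume "R \<in> chain_subdivision C" "Q \<noteq> R"
  then obtain d d' where R: "R = trap d d'" "(d, d') \<in> consecutive C"
    by (auto simp: chain_subdivision_def)
  then have d: "d < d'" by (auto simp: consecutive_def)
  have "(e, e') \<noteq> (d, d')" using Q R \<open>Q \<noteq> R\<close> by auto
  then have "e' \<le> d \<or> d' \<le> e" by (rule consecutive_disjoint[OF C Q(2) R(2)])
  then show "Q \<inter> R = {} \<or>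
        (\<exists>v. Q \<inter> R = {v} \<and> v extreme_point_of Q \<and> v extreme_point_of R) \<or>
        (Q \<inter> R edge_of Q \<and> Q \<inter> R edge_of R)"
  proof
    assume "e' \<le> d"
    from trap_Int_conforming[OF \<open>e < e'\<close> this d] show ?thesis
      by (simp only: Q(1) R(1))
  next
    assume "d' \<le> e"
    from trap_Int_conforming[OF d this \<open>e < e'\<close>] show ?thesis
      unfolding Q(1) R(1) Int_commute[of "trap e e'"] by blast
  qed
qed

text \<open>The polygons determine the consecutive pairs, and every chain element other than
  \<open>v\<close> is the first member of such a pair.\<close>

lemma inj_on_chain_subdivision: "inj_on chain_subdivision (chains_between u v)"
proof (rule inj_onI)
  fix C D assume C: "C \<in> chains_between u v" and D: "D \<in> chains_between u v"
    and eq: "chain_subdivision C = chain_subdivision D"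
  have sub: "consecutive C \<subseteq> consecutive D" if eq: "chain_subdivision C = chain_subdivision D" for C D
  proof
    fix p assume p: "p \<in> consecutive C"
    obtain e e' where pe: "p = (e, e')" by (rule prod.exhaust)
    have "trap e e' \<in> chain_subdivision C"
      unfolding chain_subdivision_def by (rule image_eqI[OF _ p]) (simp add: pe)
    then have "trap e e' \<in> chain_subdivision D" by (simp only: eq)
    then obtain d d' where d: "(d, d') \<in> consecutive D" "trap e e' = trap d d'"
      by (auto simp: chain_subdivision_def)
    then have "e = d \<and> e' = d'"
      using p pe by (intro trap_inject) (auto simp: consecutive_def less_imp_le)
    then show "p \<in> consecutive D" using d pe by simp
  qed
  have rep: "C = insert v (fst ` consecutive C)" if "C \<in> chains_between u v" for C
  proof
    show "C \<subseteq> insert v (fst ` consecutive C)"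
    proof
      fix e assume "e \<in> C"
      then show "e \<in> insert v (fst ` consecutive C)"
        using consecutive_successor[OF that, of e] by (cases "e = v") force+
    qed
    show "insert v (fst ` consecutive C) \<subseteq> C"
      using chain_ends[OF that] by (auto simp: consecutive_def)
  qed
  have "consecutive C = consecutive D" using sub[OF eq] sub[OF eq[symmetric]] by blast
  then show "C = D" using rep[OF C] rep[OF D] by simp
qed

section \<open>From subdivisions back to chains\<close>

lemma subdivision_is_chain_subdivision:
  assumes S: "subdivision (grid m n) S" and mn: "m \<ge> 2" "n \<ge> 1"
  shows "S \<in> chain_subdivision ` chains_between (0, 0) (n - 1, m - 1)"
proof -
  define T where "T = {(e, e'). e < e' \<and> trap e e' \<in> S}"
  define C where "C = fst ` T \<union> snd ` T"
  have poly: "convex_polygon Q" "{v. v extreme_point_of Q} \<subseteq> grid m n" if "Q \<in> S" for Q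
    using S that by (auto simp: subdivision_def)
  have union: "\<Union>S = trap (0, 0) (n - 1, m - 1)"
    using S mn by (simp add: subdivision_def convex_hull_grid)
  \<comment> \<open>Distinct polygons share at most a set of affine dimension 1, which has empty
    interior in the plane.\<close>
  have conform: "interior (Q \<inter> R) = {}" if "Q \<in> S" "R \<in> S" "Q \<noteq> R" for Q R
  proof -
    have "Q \<inter> R = {} \<or> (\<exists>v. Q \<inter> R = {v}) \<or> aff_dim (Q \<inter> R) = 1"
      using S[unfolded subdivision_def, THEN conjunct2, THEN conjunct2, rule_format, OF that]
      unfolding edge_of_def by blast
    then show ?thesis
      using aff_dim_nonempty_interior[of "Q \<inter> R"] by (elim disjE exE) auto
  qed
  have S_eq: "S = (\<lambda>(e, e'). trap e e') ` T"
  proof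
    show "S \<subseteq> (\<lambda>(e, e'). trap e e') ` T"
    proof
      fix Q assume "Q \<in> S"
      then obtain e e' where "e < e'" "Q = trap e e'"
        using polygon_in_grid_is_trap poly by metis
      then show "Q \<in> (\<lambda>(e, e'). trap e e') ` T" using \<open>Q \<in> S\<close> by (force simp: T_def)
    qed
  qed (auto simp: T_def)
  have disj: "e1' \<le> e2 \<or> e2' \<le> e1" if "(e1, e1') \<in> T" "(e2, e2') \<in> T" "(e1, e1') \<noteq> (e2, e2')" for e1 e1' e2 e2'
  proof (rule trap_noncrossing)
    show lt: "e1 < e1'" "e2 < e2'" using that by (auto simp: T_def)
    have "trap e1 e1' \<noteq> trap e2 e2'"
      using trap_inject[of e1 e1' e2 e2'] lt that(3) by (auto simp: less_imp_le)
    then show "interior (trap e1 e1' \<inter> trap e2 e2') = {}"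
      using that by (intro conform) (auto simp: T_def)
  qed
  have T_less: "e < e'" if "(e, e') \<in> T" for e e' using that by (auto simp: T_def)
  have T_bound: "e' \<le> (n - 1, m - 1)" if "(e, e') \<in> T" for e e'
  proof -
    have "e < e'" "trap e e' \<in> S" using that by (auto simp: T_def)
    then obtain d d' where "d < d'" "d' \<le> (n - 1, m - 1)" "trap e e' = trap d d'"
      using polygon_in_grid_is_trap poly by metis
    then show ?thesis using trap_inject[of e e' d d'] \<open>e < e'\<close> by (auto simp: less_imp_le)
  qed
  \<comment> \<open>No bounding segment runs through a polygon. This yields both the comparability
    of \<open>C\<close> and the absence of elements strictly inside a pair of
    \<open>T\<close>.\<close>
  have C_cases: "d \<le> e \<or> e' \<le> d" if "d \<in> C" "(e, e') \<in> T" for d e e'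
  proof -
    obtain f f' where f: "(f, f') \<in> T" "d = f \<or> d = f'" using \<open>d \<in> C\<close> by (auto simp: C_def)
    show ?thesis
    proof (cases "(f, f') = (e, e')")
      case True
      then show ?thesis using f by auto
    next
      case False
      then show ?thesis
        using disj[OF f(1) that(2)] f(2) T_less[OF f(1)] by (auto intro: order.trans less_imp_le)
    qed
  qed
  \<comment> \<open>At height 1/2 \<open>xpos\<close> is strictly monotone, so weak inequalities
    there identify comparable pairs; at heights 0 and 1 distinct pairs may coincide.\<close>
  have half: "\<exists>e e'. (e, e') \<in> T \<and> xpos e (1/2) \<le> x \<and> x \<le> xpos e' (1/2)"
    if "xpos (0, 0) (1/2) \<le> x" "x \<le> xpos (n - 1, m - 1) (1/2)" for x
  proof -
    have "(x, 1/2) \<in> \<Union>S" unfolding union using that by (simp add: trap_def)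
    then obtain e e' where "(e, e') \<in> T" "(x, 1/2) \<in> trap e e'" unfolding S_eq by blast
    then show ?thesis by (intro exI[of _ e] exI[of _ e']) (simp add: trap_def)
  qed
  have bot_top: "(0, 0) \<le> (n - 1, m - 1)" by (simp add: less_eq_prod_def)
  have mono: "xpos e (1/2) < xpos e' (1/2)" if "e < e'" for e e'
    using xpos_strict_mono[OF that] by simp
  have "C \<in> chains_between (0, 0) (n - 1, m - 1)"
    unfolding chains_between_def
  proof (intro CollectI conjI ballI)
    show "C \<subseteq> {(0, 0)..(n - 1, m - 1)}"
    proof
      fix x assume "x \<in> C"
      then obtain f f' where f: "(f, f') \<in> T" "x = f \<or> x = f'" by (auto simp: C_def)
      then have "x \<le> f'" using T_less[OF f(1)] by (auto intro: less_imp_le)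
      also have "f' \<le> (n - 1, m - 1)" using f(1) by (rule T_bound)
      finally show "x \<in> {(0, 0)..(n - 1, m - 1)}" by (simp add: less_eq_prod_def)
    qed
    have "xpos (0, 0) (1/2) \<le> xpos (n - 1, m - 1) (1/2)"
      using bot_top by (intro xpos_mono) auto
    then obtain e e' d d' where e: "(e, e') \<in> T" "xpos e (1/2) \<le> xpos (0, 0) (1/2)"
      and d: "(d, d') \<in> T" "xpos (n - 1, m - 1) (1/2) \<le> xpos d' (1/2)"
      using half by (metis order_refl)
    have "(0, 0) \<le> e" by (simp add: less_eq_prod_def)
    then have "e = (0, 0)" using e(2) mono[of "(0, 0)" e] by (auto simp: order_le_less)
    then show "(0, 0) \<in> C" using e(1) by (force simp: C_def)
    have "d' = (n - 1, m - 1)"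
      using T_bound[OF d(1)] d(2) mono[of d' "(n - 1, m - 1)"] by (auto simp: order_le_less)
    then show "(n - 1, m - 1) \<in> C" using d(1) by (force simp: C_def)
    fix x y assume "x \<in> C" "y \<in> C"
    then obtain f f' where f: "(f, f') \<in> T" "y = f \<or> y = f'" by (auto simp: C_def)
    then show "x \<le> y \<or> y \<le> x"
      using C_cases[OF \<open>x \<in> C\<close> f(1)] T_less[OF f(1)] by (auto intro: order.trans less_imp_le)
  qed
  moreover have "T = consecutive C"
  proof
    show "T \<subseteq> consecutive C"
    proof
      fix p assume "p \<in> T"
      then obtain e e' where p: "p = (e, e')" "(e, e') \<in> T" by (cases p) auto
      have "\<not> (e < d \<and> d < e')" if "d \<in> C" for d
        using C_cases[OF that p(2)] by (simp only: less_le_not_le) blast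
      moreover have "e \<in> C" "e' \<in> C" using p(2) by (force simp: C_def)+
      ultimately show "p \<in> consecutive C"
        using p T_less[OF p(2)] by (simp add: consecutive_def)
    qed
    show "consecutive C \<subseteq> T"
    proof
      fix p assume "p \<in> consecutive C"
      then obtain c c' where p: "p = (c, c')" and c: "c \<in> C" "c' \<in> C" "c < c'"
        and no: "\<And>d. d \<in> C \<Longrightarrow> \<not> (c < d \<and> d < c')"
        by (auto simp: consecutive_def)
      have C: "C \<in> chains_between (0, 0) (n - 1, m - 1)" by fact
      \<comment> \<open>A point strictly between two consecutive segments is covered by some
        polygon. That polygon can end neither before nor beyond them, so its sides are
        \<open>c\<close> and \<open>c'\<close>.\<close>
      define x where "x = (xpos c (1/2) + xpos c' (1/2)) / 2"
      have x: "xpos c (1/2) < x" "x < xpos c' (1/2)" using mono[OF c(3)] by (auto simp: x_def)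
      have "xpos (0, 0) (1/2) \<le> xpos c (1/2)" "xpos c' (1/2) \<le> xpos (n - 1, m - 1) (1/2)"
        using chain_bounds[OF C c(1)] chain_bounds[OF C c(2)] by (auto intro!: xpos_mono)
      then obtain e e' where e: "(e, e') \<in> T" "xpos e (1/2) \<le> x" "x \<le> xpos e' (1/2)"
        using half[of x] x by auto
      have eC: "e \<in> C" "e' \<in> C" using e(1) by (force simp: C_def)+
      have "\<not> c' \<le> e"
        using xpos_mono[of c' e "1/2"] e(2) x by auto
      then have "e < c'" using chain_comparable[OF C c(2) eC(1)] by blast
      then have "\<not> c < e" using no[OF eC(1)] by blast
      have "\<not> e' \<le> c"
        using xpos_mono[of e' c "1/2"] e(3) x by auto
      then have "c < e'" using chain_comparable[OF C eC(2) c(1)] by blast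
      have "c \<le> e" using C_cases[OF c(1) e(1)] \<open>\<not> e' \<le> c\<close> by blast
      then have "c = e" using \<open>\<not> c < e\<close> by (simp add: order_le_less)
      have "e' \<le> c'" using C_cases[OF c(2) e(1)] \<open>\<not> c' \<le> e\<close> by blast
      then have "e' = c'" using no[OF eC(2)] \<open>c < e'\<close> by (simp add: order_le_less)
      then show "p \<in> T" using e(1) p \<open>c = e\<close> by simp
    qed
  qed
  ultimately show ?thesis using S_eq by (auto simp: chain_subdivision_def)
qed

lemma bij_betw_chain_subdivision:
  assumes "m \<ge> 2" "n \<ge> 1"
  shows "bij_betw chain_subdivision (chains_between (0, 0) (n - 1, m - 1)) {S. subdivision (grid m n) S}"
proof (rule bij_betw_imageI[OF inj_on_chain_subdivision], intro equalityI subsetI)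
  fix S assume "S \<in> {S. subdivision (grid m n) S}"
  then show "S \<in> chain_subdivision ` chains_between (0, 0) (n - 1, m - 1)"
    using assms by (intro subdivision_is_chain_subdivision) auto
next
  fix S assume "S \<in> chain_subdivision ` chains_between (0, 0) (n - 1, m - 1)"
  then obtain C where "C \<in> chains_between (0, 0) (n - 1, m - 1)" "S = chain_subdivision C" ..
  then show "S \<in> {S. subdivision (grid m n) S}"
    using subdivision_chain_subdivision[OF _ assms] by simp
qed

section \<open>Bimonotonicity and the limit\<close>

lemma bimonotone_trap:
  assumes lt: "e < e'" and "fst e \<le> snd e" "fst e' \<le> snd e'"
  shows "bimonotone (trap e e')"
  unfolding bimonotone_def
proof (intro allI impI)
  fix p q assume edge: "closed_segment p q edge_of trap e e'"
  then have face: "closed_segment p q face_of trap e e'" by (simp add: edge_of_def)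
  have "p extreme_point_of trap e e'" "q extreme_point_of trap e e'"
    using extreme_point_of_face[OF face, of p] extreme_point_of_face[OF face, of q]
    by (simp_all add: extreme_point_of_segment)
  then have pq: "p \<in> corners e e'" "q \<in> corners e e'"
    using extreme_point_of_trap[of e e'] lt by auto
  have le: "e \<le> e'" using lt by simp
  \<comment> \<open>Among the segments joining corners in different rows, only the one from the
    bottom right to the top left corner can lean backwards. It is a face only if the trapezoid
    degenerates to a triangle, and then it coincides with the left or right side.\<close>
  have diag: "fst e = fst e' \<or> snd e = snd e'"
    if seg: "closed_segment (real (fst e'), 0) (real (snd e), 1) face_of trap e e'"
  proof (rule ccontr)
    assume "\<not> ?thesis"
    then have ne: "fst e < fst e'" "snd e < snd e'"
      using le by (auto simp: less_eq_prod_def)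
    define x where "x = xpos (fst e', snd e) (1/2)"
    have xs: "(x, 1/2 :: real) \<in> closed_segment (real (fst e'), 0) (real (snd e), 1)"
      using xpos_point_in_segment[of "1/2" "(fst e', snd e)"] by (simp add: x_def)
    have x: "xpos e (1/2) < x" "x < xpos e' (1/2)" using ne by (auto simp: x_def xpos_def)
    \<comment> \<open>The diagonal's midpoint lies strictly inside the horizontal chord at its
      height, so a face containing it would contain the chord's left end, which is off the
      diagonal.\<close>
    have "(x, 1/2 :: real) \<in> open_segment (xpos e (1/2), 1/2) (xpos e' (1/2), 1/2)"
    proof -
      have "x \<in> open_segment (xpos e (1/2)) (xpos e' (1/2))"
        using x by (simp add: open_segment_eq_real_ivl)
      then obtain u where "xpos e (1/2) \<noteq> xpos e' (1/2)" "0 < u" "u < 1"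
          "x = (1 - u) * xpos e (1/2) + u * xpos e' (1/2)"
        unfolding in_segment by auto
      then show ?thesis
        unfolding in_segment by (intro conjI exI[of _ u]) (simp_all add: field_simps)
    qed
    moreover have "(xpos e (1/2), 1/2) \<in> trap e e'" "(xpos e' (1/2), 1/2) \<in> trap e e'"
      using x by (auto simp: trap_def)
    ultimately have "(xpos e (1/2), 1/2 :: real) \<in> closed_segment (real (fst e'), 0) (real (snd e), 1)"
      using face_ofD[OF seg _ _ _ xs] by blast
    then have "(xpos e (1/2), 1/2) \<in> trap (fst e', snd e) (fst e', snd e)"
      by (simp add: trap_self)
    then show False using x by (simp add: trap_def x_def)
  qed
  have up: "fst p \<le> fst q"
    if "p \<in> corners e e'" "q \<in> corners e e'" "snd p = 0" "snd q = 1"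
      "closed_segment p q face_of trap e e'" for p q
    using that diag assms(2,3) le by (auto simp: corners_def less_eq_prod_def)
  have "snd p = snd q \<or> snd p = 0 \<and> snd q = 1 \<or> snd q = 0 \<and> snd p = 1"
    using pq by (auto simp: corners_def)
  then show "fst p = fst q \<or> (snd q - snd p) / (fst q - fst p) \<ge> 0"
  proof (elim disjE conjE)
    assume "snd p = 0" "snd q = 1"
    then show ?thesis using up[OF pq _ _ face] by auto
  next
    assume "snd q = 0" "snd p = 1"
    then have "fst q \<le> fst p"
      using up[of q p] pq face by (simp add: closed_segment_commute)
    then show ?thesis using \<open>snd q = 0\<close> \<open>snd p = 1\<close> by (simp add: divide_nonpos_nonpos)
  qed simp
qed

lemma bimonotone_chain_subdivision:
  assumes "m \<ge> 2" "n \<ge> 1" and C: "C \<in> chains_between (0, 0) (n - 1, m - 1)"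
    and up: "\<forall>e\<in>C. fst e \<le> snd e"
  shows "bimonotone_subdivision (grid m n) (chain_subdivision C)"
  unfolding bimonotone_subdivision_def
proof (intro conjI ballI)
  show "subdivision (grid m n) (chain_subdivision C)"
    using subdivision_chain_subdivision assms by blast
  fix Q assume "Q \<in> chain_subdivision C"
  then show "bimonotone Q"
    using up by (auto simp: chain_subdivision_def consecutive_def intro!: bimonotone_trap)
qed

theorem corollary1:
  fixes n :: nat
  assumes "n \<ge> 1"
  shows "(\<lambda>m. real (num_bimonotone_subdivisions m n) / real (num_subdivisions m n))
           \<longlonglongrightarrow> 1"
proof -
  define k where "k = n - 1"
  define A :: "nat \<Rightarrow> (nat \<times> nat) set set" where "A q = chains_between (0, 0) (k, q)" for q
  define L where "L q = {C \<in> A q. \<not> (\<forall>e\<in>C. fst e \<le> snd e)}" for q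
  define r where "r m = real (num_bimonotone_subdivisions m n) / real (num_subdivisions m n)" for m
  \<comment> \<open>Chains outside \<open>L q\<close> inject into the bimonotone subdivisions, which
    gives the lower estimate. Here \<open>m = Suc q\<close>, and \<open>q \<ge> 1\<close> is the
    range \<open>m \<ge> 2\<close> of the bijection.\<close>
  have bounds: "1 - real (card (L q)) / real (card (A q)) \<le> r (Suc q) \<and> r (Suc q) \<le> 1" if "q \<ge> 1" for q
  proof -
    have bij: "bij_betw chain_subdivision (A q) {S. subdivision (grid (Suc q) n) S}"
      using bij_betw_chain_subdivision[of "Suc q" n] that assms by (simp add: A_def k_def)
    have fin: "finite (A q)" unfolding A_def by (simp add: finite_chains_between)
    have num: "num_subdivisions (Suc q) n = card (A q)"
      unfolding num_subdivisions_def using bij_betw_same_card[OF bij] by simp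
    have finS: "finite {S. subdivision (grid (Suc q) n) S}"
      using bij fin bij_betw_finite by blast
    have "num_bimonotone_subdivisions (Suc q) n \<le> card (A q)"
      unfolding num_bimonotone_subdivisions_def num[symmetric] num_subdivisions_def
      by (rule card_mono[OF finS]) (auto simp: bimonotone_subdivision_def)
    moreover have "card (A q - L q) \<le> num_bimonotone_subdivisions (Suc q) n"
      unfolding num_bimonotone_subdivisions_def
    proof (rule card_inj_on_le)
      show "inj_on chain_subdivision (A q - L q)"
        using bij by (auto simp: bij_betw_def intro: inj_on_subset)
      show "chain_subdivision ` (A q - L q) \<subseteq> {S. bimonotone_subdivision (grid (Suc q) n) S}"
        using bimonotone_chain_subdivision[of "Suc q" n] that assms by (auto simp: A_def L_def k_def)
      show "finite {S. bimonotone_subdivision (grid (Suc q) n) S}"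
        by (rule finite_subset[OF _ finS]) (auto simp: bimonotone_subdivision_def)
    qed
    moreover have "card (A q - L q) = card (A q) - card (L q)" "card (L q) \<le> card (A q)"
      using fin by (auto simp: L_def intro!: card_Diff_subset card_mono)
    moreover have "1 \<le> card (A q)"
      unfolding A_def by (intro card_chains_between_pos) (auto simp: less_eq_prod_def)
    ultimately have le: "real (num_bimonotone_subdivisions (Suc q) n) \<le> real (card (A q))"
      "real (card (A q)) - real (card (L q)) \<le> real (num_bimonotone_subdivisions (Suc q) n)"
      "0 < real (card (A q))"
      by linarith+
    then have "1 - real (card (L q)) / real (card (A q)) =
        (real (card (A q)) - real (card (L q))) / real (card (A q))"
      by (simp add: diff_divide_distrib)
    also have "\<dots> \<le> r (Suc q)"
      unfolding r_def num using le by (intro divide_right_mono) auto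
    finally show ?thesis
      using le unfolding r_def num by simp
  qed
  have "(\<lambda>q. 1 - real (card (L q)) / real (card (A q))) \<longlonglongrightarrow> 1 - 0"
    unfolding L_def A_def by (intro tendsto_intros low_chains_negligible)
  then have lower: "(\<lambda>q. 1 - real (card (L q)) / real (card (A q))) \<longlonglongrightarrow> 1"
    by simp
  have "(\<lambda>q. r (Suc q)) \<longlonglongrightarrow> 1"
  proof (rule tendsto_sandwich[OF _ _ lower tendsto_const])
    show "\<forall>\<^sub>F q in sequentially. 1 - real (card (L q)) / real (card (A q)) \<le> r (Suc q)"
      using bounds by (intro eventually_sequentiallyI[of 1]) blast
    show "\<forall>\<^sub>F q in sequentially. r (Suc q) \<le> 1"
      using bounds by (intro eventually_sequentiallyI[of 1]) blast
  qed
  then have "r \<longlonglongrightarrow> 1" by (rule LIMSEQ_imp_Suc)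
  then show ?thesis by (simp add: r_def[abs_def])
qed

end
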